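(* Let $G$ be a connected toroidal graph (a finite simple graph embeddable in the torus) that contains no subgraph isomorphic to $C_1$ and no subgraph isomorphic to $C_2$, where $C_1$ and $C_2$ are the graphs described in the context. Then $G$ has minimum degree at most three, unless $G$ is a $2$-connected $4$-regular graph with Euler characteristic $\epsilon(G)=0$.
   Context: $C_1$ (the "house") is the graph on vertices $a,b,c,d,h$ with edges $ab,bc,cd,da,ah,hb$; equivalently a $4$-cycle $abcd$ together with a triangle $abh$ sharing the edge $ab$. $C_2$ is the graph on vertices $u_1,\dots,u_5,x,y$ with edges $u_1u_2,u_2u_3,u_3u_4,u_4u_5,u_5u_1$ (a $5$-cycle), $xu_5,xu_1$ and $yu_1,yu_2$; i.e. a $5$-cycle with two triangles attached on the two consecutive edges $u_5u_1$ and $u_1u_2$. "Subgraph" means not necessarily induced. For a connected toroidal graph $G$, $\epsilon(G)$ denotes $|V(G)|-|E(G)|+|F(G)|$ for a $2$-cell embedding of $G$ in the plane or the torus, i.e. the Euler characteristic of that surface ($2$ for the plane/sphere, $0$ for the torus); thus $\epsilon(G)=0$ means the $2$-cell embedding is in the torus. *)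

theory Defs
  imports Main
begin

text \<open>Finite simple graphs: vertex set V, symmetric irreflexive adjacency E inside V.\<close>

definition simple_graph :: "'a set \<Rightarrow> ('a \<Rightarrow> 'a \<Rightarrow> bool) \<Rightarrow> bool" where
  "simple_graph V E \<longleftrightarrow> finite V \<and> (\<forall>u v. E u v \<longrightarrow> u \<in> V \<and> v \<in> V \<and> E v u \<and> u \<noteq> v)"

definition nbrs :: "'a set \<Rightarrow> ('a \<Rightarrow> 'a \<Rightarrow> bool) \<Rightarrow> 'a \<Rightarrow> 'a set" where
  "nbrs V E v = {u \<in> V. E v u}"

definition degree :: "'a set \<Rightarrow> ('a \<Rightarrow> 'a \<Rightarrow> bool) \<Rightarrow> 'a \<Rightarrow> nat" where
  "degree V E v = card (nbrs V E v)"

definition edge_set :: "'a set \<Rightarrow> ('a \<Rightarrow> 'a \<Rightarrow> bool) \<Rightarrow> 'a set set" where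
  "edge_set V E = {{u, v} | u v. u \<in> V \<and> v \<in> V \<and> E u v}"

definition connected_graph :: "'a set \<Rightarrow> ('a \<Rightarrow> 'a \<Rightarrow> bool) \<Rightarrow> bool" where
  "connected_graph V E \<longleftrightarrow> V \<noteq> {} \<and>
     (\<forall>u\<in>V. \<forall>v\<in>V. (u, v) \<in> {(x, y). x \<in> V \<and> y \<in> V \<and> E x y}\<^sup>*)"

text \<open>2-connected: at least 3 vertices and deleting any single vertex leaves a connected graph.\<close>
definition two_connected :: "'a set \<Rightarrow> ('a \<Rightarrow> 'a \<Rightarrow> bool) \<Rightarrow> bool" where
  "two_connected V E \<longleftrightarrow> card V \<ge> 3 \<and> connected_graph V E \<and>
     (\<forall>x\<in>V. connected_graph (V - {x}) (\<lambda>u v. E u v \<and> u \<noteq> x \<and> v \<noteq> x))"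

definition regular :: "'a set \<Rightarrow> ('a \<Rightarrow> 'a \<Rightarrow> bool) \<Rightarrow> nat \<Rightarrow> bool" where
  "regular V E k \<longleftrightarrow> (\<forall>v\<in>V. degree V E v = k)"

definition min_degree_le :: "'a set \<Rightarrow> ('a \<Rightarrow> 'a \<Rightarrow> bool) \<Rightarrow> nat \<Rightarrow> bool" where
  "min_degree_le V E k \<longleftrightarrow> (\<exists>v\<in>V. degree V E v \<le> k)"

text \<open>(Not necessarily induced) subgraphs isomorphic to C1 (house) and C2.\<close>
definition has_C1 :: "'a set \<Rightarrow> ('a \<Rightarrow> 'a \<Rightarrow> bool) \<Rightarrow> bool" where
  "has_C1 V E \<longleftrightarrow> (\<exists>a b c d h. a \<in> V \<and> b \<in> V \<and> c \<in> V \<and> d \<in> V \<and> h \<in> V \<and>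
     distinct [a, b, c, d, h] \<and>
     E a b \<and> E b c \<and> E c d \<and> E d a \<and> E a h \<and> E h b)"

definition has_C2 :: "'a set \<Rightarrow> ('a \<Rightarrow> 'a \<Rightarrow> bool) \<Rightarrow> bool" where
  "has_C2 V E \<longleftrightarrow> (\<exists>u1 u2 u3 u4 u5 x y.
     u1 \<in> V \<and> u2 \<in> V \<and> u3 \<in> V \<and> u4 \<in> V \<and> u5 \<in> V \<and> x \<in> V \<and> y \<in> V \<and>
     distinct [u1, u2, u3, u4, u5, x, y] \<and>
     E u1 u2 \<and> E u2 u3 \<and> E u3 u4 \<and> E u4 u5 \<and> E u5 u1 \<and>
     E x u5 \<and> E x u1 \<and> E y u1 \<and> E y u2)"

text \<open>Combinatorial embeddings (rotation systems). rot v is a cyclic permutation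
  of the neighbourhood of v.\<close>
definition rotation_system :: "'a set \<Rightarrow> ('a \<Rightarrow> 'a \<Rightarrow> bool) \<Rightarrow> ('a \<Rightarrow> 'a \<Rightarrow> 'a) \<Rightarrow> bool" where
  "rotation_system V E rot \<longleftrightarrow> (\<forall>v\<in>V.
     bij_betw (rot v) (nbrs V E v) (nbrs V E v) \<and>
     (\<forall>u\<in>nbrs V E v. \<forall>w\<in>nbrs V E v. \<exists>k. (rot v ^^ k) u = w))"

definition darts :: "'a set \<Rightarrow> ('a \<Rightarrow> 'a \<Rightarrow> bool) \<Rightarrow> ('a \<times> 'a) set" where
  "darts V E = {(u, v). u \<in> V \<and> v \<in> V \<and> E u v}"

text \<open>Face-tracing permutation on darts.\<close>
definition face_step :: "('a \<Rightarrow> 'a \<Rightarrow> 'a) \<Rightarrow> 'a \<times> 'a \<Rightarrow> 'a \<times> 'a" where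
  "face_step rot d = (snd d, rot (snd d) (fst d))"

definition faces :: "'a set \<Rightarrow> ('a \<Rightarrow> 'a \<Rightarrow> bool) \<Rightarrow> ('a \<Rightarrow> 'a \<Rightarrow> 'a) \<Rightarrow> ('a \<times> 'a) set set" where
  "faces V E rot = (\<lambda>d. {(face_step rot ^^ k) d | k. True}) ` darts V E"

text \<open>|V| - |E| + |F| of the 2-cell embedding determined by a rotation system.\<close>
definition emb_char :: "'a set \<Rightarrow> ('a \<Rightarrow> 'a \<Rightarrow> bool) \<Rightarrow> ('a \<Rightarrow> 'a \<Rightarrow> 'a) \<Rightarrow> int" where
  "emb_char V E rot = int (card V) - int (card (edge_set V E)) + int (card (faces V E rot))"

text \<open>Toroidal: embeddable in the torus, i.e. orientable genus at most 1.\<close>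
definition toroidal :: "'a set \<Rightarrow> ('a \<Rightarrow> 'a \<Rightarrow> bool) \<Rightarrow> bool" where
  "toroidal V E \<longleftrightarrow> (\<exists>rot. rotation_system V E rot \<and> emb_char V E rot \<ge> 0)"

text \<open>Euler characteristic epsilon(G) = 2 - 2 genus(G), the characteristic of a minimum-genus
  (2-cell) embedding.\<close>
definition euler_char :: "'a set \<Rightarrow> ('a \<Rightarrow> 'a \<Rightarrow> bool) \<Rightarrow> int" where
  "euler_char V E = Max {emb_char V E rot | rot. rotation_system V E rot}"

end

theory Submission
  imports Defs "HOL-Combinatorics.Orbits"
begin

text \<open>
  Discharging. Suppose all degrees are at least 4 and fix any rotation system. Give each vertex
  the charge \<open>deg - 4\<close> and each face the charge \<open>length - 4\<close>; the total is \<open>-4 * emb_char\<close>.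
  A triangular face has charge \<open>-1\<close>. Excluding the house, a triangle is never adjacent
  to a 4-face and is adjacent to at most one other triangle. Let a larger face give a triangle across
  a common edge \<open>1/3\<close>, or \<open>1/2\<close> if that triangle is itself adjacent to a triangle: then every
  triangle receives exactly 1. Excluding the second graph, no two consecutive edges of a 5-face
  border triangles, so it gives at most 1. In a face of length at least 6, split each \<open>1/2\<close>
  into \<open>1/3\<close> at the endpoint shared with the second triangle and \<open>1/6\<close> at the other endpoint, and
  each \<open>1/3\<close> into two halves; then each corner at a vertex of degree 4 gives at most \<open>1/3\<close>, in total
  at most \<open>length - 4\<close>. Vertices of degree at least 5 strictly pay for the excess at their corners.
  Hence \<open>emb_char \<le> 0\<close>, and equality forces 4-regularity and no slack at any face. Without slack,
  faces have length at most 6 and every corner of a 6-face borders a triangle, which prevents a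
  face boundary from visiting a vertex twice; so rotating around a vertex \<open>x\<close> links its neighbours
  by paths that avoid \<open>x\<close>.
\<close>

section \<open>Orbits of permutations\<close>

lemma orbit_eq_funpow_image:
  assumes "(f ^^ n) x = x" "0 < n"
  shows "orbit f x = (\<lambda>i. (f ^^ i) x) ` {..<n}"
  using orbit_altdef_bounded[OF assms] by auto

lemma orbit_as_cycle:
  assumes "x \<in> orbit f x"
  defines "n \<equiv> card (orbit f x)"
  shows "0 < n" "(f ^^ n) x = x" "inj_on (\<lambda>i. (f ^^ i) x) {..<n}"
    "orbit f x = (\<lambda>i. (f ^^ i) x) ` {..<n}"
proof -
  have im: "orbit f x = (\<lambda>i. (f ^^ i) x) ` {0..<funpow_dist1 f x x}"
    by (rule orbit_conv_funpow_dist1[OF assms(1)])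
  have "n = funpow_dist1 f x x"
    unfolding n_def im using card_image[OF inj_on_funpow_dist1[OF assms(1)]] by simp
  then show "0 < n" "(f ^^ n) x = x" "inj_on (\<lambda>i. (f ^^ i) x) {..<n}"
    "orbit f x = (\<lambda>i. (f ^^ i) x) ` {..<n}"
    using im funpow_dist1_prop[OF assms(1)] inj_on_funpow_dist1[OF assms(1)]
    by (auto simp: lessThan_atLeast0)
qed

lemma sum_orbit:
  assumes "x \<in> orbit f x"
  shows "(\<Sum>y\<in>orbit f x. g y) = (\<Sum>i<card (orbit f x). g ((f ^^ i) x))"
  by (subst orbit_as_cycle(4)[OF assms], subst sum.reindex)
     (use orbit_as_cycle(3)[OF assms] in auto)

lemma self_in_orbit_finite:
  assumes "finite D" "bij_betw f D D" "x \<in> D"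
  shows "x \<in> orbit f x"
proof -
  \<comment> \<open>The library speaks of permutations of the whole type, so \<open>f\<close> is
    extended by the identity outside \<open>D\<close>; on the orbit of \<open>x\<close> nothing
    changes.\<close>
  define g where "g = (\<lambda>y. if y \<in> D then f y else y)"
  have "bij_betw g D D"
    using assms(2) bij_betw_cong[of D g f D] by (simp add: g_def)
  then have "g permutes D"
    by (rule bij_imp_permutes) (simp add: g_def)
  then have "permutation g"
    using assms(1) permutation_permutes by blast
  then have "x \<in> orbit g x"
    by (rule permutation_self_in_orbit)
  moreover have "orbit g x = orbit f x"
    using assms(2,3) by (intro orbit_cong0[of x D]) (auto simp: g_def bij_betw_def)
  ultimately show ?thesis by simp
qed

section \<open>Local structure around triangular faces\<close>

text \<open>The rotation system is arbitrary: \<open>euler_char\<close> is a maximum over all of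
  them, so the bound \<open>emb_char \<le> 0\<close> is wanted for each one, not just for the
  toroidal one.\<close>

locale house_free_embedding =
  fixes V :: "'a set" and E :: "'a \<Rightarrow> 'a \<Rightarrow> bool" and rot :: "'a \<Rightarrow> 'a \<Rightarrow> 'a"
  assumes simple: "simple_graph V E"
    and rotation: "rotation_system V E rot"
    and degree_ge_4: "v \<in> V \<Longrightarrow> 4 \<le> degree V E v"
    and no_C1: "\<not> has_C1 V E"
    and no_C2: "\<not> has_C2 V E"
begin

section \<open>Consecutive neighbours in a rotation\<close>

lemma finite_V: "finite V"
  using simple by (simp add: simple_graph_def)

lemma adj_sym: "E u v \<Longrightarrow> E v u"
  and adj_neq: "E u v \<Longrightarrow> u \<noteq> v"
  and adj_in_V: "E u v \<Longrightarrow> u \<in> V" "E u v \<Longrightarrow> v \<in> V"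
  using simple by (auto simp: simple_graph_def)

lemma nbrs_iff: "u \<in> nbrs V E v \<longleftrightarrow> E v u"
  using adj_in_V by (auto simp: nbrs_def)

lemma finite_nbrs: "finite (nbrs V E v)"
  using finite_V by (simp add: nbrs_def)

lemma rot_bij: "v \<in> V \<Longrightarrow> bij_betw (rot v) (nbrs V E v) (nbrs V E v)"
  and rot_transitive: "E v u \<Longrightarrow> E v w \<Longrightarrow> \<exists>k. (rot v ^^ k) u = w"
  using rotation adj_in_V nbrs_iff by (auto simp: rotation_system_def)

lemma rot_adj: "E v u \<Longrightarrow> E v (rot v u)"
  using rot_bij[of v] adj_in_V(1) nbrs_iff by (metis bij_betwE)

lemma rot_inj: "E v u \<Longrightarrow> E v u' \<Longrightarrow> rot v u = rot v u' \<Longrightarrow> u = u'"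
  using rot_bij[of v] adj_in_V(1) nbrs_iff by (metis bij_betw_imp_inj_on inj_onD)

lemma nbrs_eq_orbit:
  assumes "E v u" shows "u \<in> orbit (rot v) u" "nbrs V E v = orbit (rot v) u"
proof -
  have "v \<in> V" using assms adj_in_V by blast
  then show self: "u \<in> orbit (rot v) u"
    using self_in_orbit_finite[OF finite_nbrs rot_bij] assms by (simp add: nbrs_iff)
  have "E v ((rot v ^^ k) u)" for k
    using assms by (induction k) (auto simp: rot_adj)
  then show "nbrs V E v = orbit (rot v) u"
    using rot_transitive[OF assms] by (auto simp: orbit_altdef_self_in[OF self] nbrs_iff) metis
qed

text \<open>A return after \<open>k\<close> steps would make the whole neighbourhood, a single
  orbit, have at most \<open>k\<close> < 4 elements. This separates up to four consecutive
  neighbours in all the arguments below.\<close>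

lemma rot_funpow_neq:
  assumes "E v u" "0 < k" "k < 4" shows "(rot v ^^ k) u \<noteq> u"
proof
  assume "(rot v ^^ k) u = u"
  then have "nbrs V E v = (\<lambda>i. (rot v ^^ i) u) ` {..<k}"
    using orbit_eq_funpow_image assms nbrs_eq_orbit by metis
  then have "degree V E v \<le> k"
    unfolding degree_def by (metis card_image_le finite_lessThan card_lessThan)
  then show False
    using degree_ge_4[of v] assms adj_in_V by fastforce
qed

lemma rot_neq:
  assumes "E v u"
  shows "rot v u \<noteq> u" "rot v (rot v u) \<noteq> u" "rot v (rot v (rot v u)) \<noteq> u"
  using rot_funpow_neq[OF assms, of 1] rot_funpow_neq[OF assms, of 2] rot_funpow_neq[OF assms, of 3]
  by (auto simp: numeral_eq_Suc)

lemma rot_degree_4: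
  assumes "E v u" "degree V E v = 4"
  shows "rot v (rot v (rot v (rot v u))) = u"
    and "E v w \<Longrightarrow> w \<in> {u, rot v u, rot v (rot v u), rot v (rot v (rot v u))}"
proof -
  have card: "card (orbit (rot v) u) = 4"
    using assms nbrs_eq_orbit(2) by (simp add: degree_def)
  show "rot v (rot v (rot v (rot v u))) = u"
    using orbit_as_cycle(2)[OF nbrs_eq_orbit(1)[OF assms(1)]]
    by (simp add: card) (simp add: numeral_eq_Suc)
  assume "E v w"
  then have "w \<in> (\<lambda>i. (rot v ^^ i) u) ` {..<4}"
    using orbit_as_cycle(4)[OF nbrs_eq_orbit(1)[OF assms(1)]] nbrs_eq_orbit(2)[OF assms(1)]
    by (simp add: card nbrs_iff[symmetric])
  then show "w \<in> {u, rot v u, rot v (rot v u), rot v (rot v (rot v u))}"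
    by (auto simp: numeral_eq_Suc lessThan_Suc)
qed

section \<open>Configurations of short faces that are excluded\<close>

lemma house:
  assumes "E a b" "E b c" "E c d" "E d a" "E a h" "E h b" "a \<noteq> c" "b \<noteq> d" "h \<noteq> c" "h \<noteq> d"
  shows False
proof -
  have "distinct [a, b, c, d, h]"
    using assms(7-10) assms(1-6)[THEN adj_neq] by auto
  then have "has_C1 V E"
    unfolding has_C1_def using assms(1-6) assms(1-5)[THEN adj_in_V(1)] assms(6)[THEN adj_in_V(1)]
    by blast
  then show False using no_C1 by simp
qed

lemma double_house:
  assumes "E a b" "E b c" "E c d" "E d e" "E e a" "E x e" "E x a" "E y a" "E y b"
    "a \<noteq> c" "a \<noteq> d" "b \<noteq> d" "b \<noteq> e" "c \<noteq> e"
    "x \<noteq> b" "x \<noteq> c" "x \<noteq> d" "x \<noteq> y" "y \<noteq> c" "y \<noteq> d" "y \<noteq> e"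
  shows False
proof -
  have "distinct [a, b, c, d, e, x, y]"
    using assms(10-21) assms(1-9)[THEN adj_neq] by auto
  then have "has_C2 V E"
    unfolding has_C2_def using assms(1-9) assms(1-9)[THEN adj_in_V(1)] by blast
  then show False using no_C2 by simp
qed

text \<open>Concerns facial triangles only, not arbitrary 3-cycles: face tracing from the dart
  \<open>(u, v)\<close> closes after three steps. The face on the other side of the same edge is
  tested by \<open>tri v u\<close>.\<close>

definition tri :: "'a \<Rightarrow> 'a \<Rightarrow> bool" where
  "tri u v \<longleftrightarrow> E u v \<and> rot (rot v u) v = u \<and> rot u (rot v u) = v"

lemma triD:
  assumes "tri u v"
  obtains w where "rot v u = w" "rot w v = u" "rot u w = v" "E u v" "E v w" "E w u"
    "tri v w" "tri w u"
proof -
  define w where "w = rot v u"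
  have a: "rot v u = w" "rot w v = u" "rot u w = v" "E u v"
    using assms by (auto simp: tri_def w_def)
  moreover have "E v w" using a rot_adj adj_sym by metis
  moreover have "E w u" using calculation rot_adj adj_sym by metis
  ultimately show ?thesis using that by (simp add: tri_def)
qed

text \<open>With apexes \<open>x\<close> and \<open>y\<close> of the outer triangles, the rotation
  at \<open>v\<close> reads \<open>x\<close>, \<open>u\<close>, \<open>w\<close>, \<open>y\<close>.
  The 4-cycle \<open>v w u x\<close> with roof \<open>y\<close> over \<open>v w\<close> is a
  house.\<close>

lemma no_two_adjacent_triangles:
  assumes "tri u v" "tri v u" "tri (rot v u) v" shows False
proof -
  obtain w where w: "rot v u = w" "rot w v = u" "rot u w = v" "E u v" "E v w" "E w u"
    using triD[OF assms(1)] by metis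
  obtain x where x: "rot u v = x" "rot x u = v" "rot v x = u" "E u x" "E x v"
    using triD[OF assms(2)] by metis
  obtain y where y: "rot v w = y" "E v y" "E y w"
    using triD[OF assms(3)] w(1) by metis
  have "E v x" using x adj_sym by blast
  then have "x \<noteq> u" "x \<noteq> w" "x \<noteq> y" "u \<noteq> y"
    using rot_neq[of v x] rot_neq[of v u] w x y adj_sym by metis+
  then show False
    using house[OF \<open>E v w\<close> \<open>E w u\<close> \<open>E u x\<close> \<open>E x v\<close> \<open>E v y\<close> \<open>E y w\<close>] w(4) adj_neq by metis
qed

lemma no_triangle_next_to_quadrangle:
  assumes "E a b" "rot b a = c" "rot c b = d" "rot d c = a" "rot a d = b" "tri b a"
  shows False
proof -
  obtain h where h: "rot a b = h" "rot h a = b" "rot b h = a" "E a h" "E h b"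
    using triD[OF assms(6)] by metis
  have bc: "E b c" using assms(1,2) rot_adj adj_sym by metis
  have cd: "E c d" using bc assms(3) rot_adj adj_sym by metis
  have da: "E d a" using cd assms(4) rot_adj adj_sym by metis
  have "a \<noteq> c" using rot_neq(1)[of b a] assms adj_sym by metis
  moreover have "b \<noteq> d" using rot_neq(1)[of c b] assms bc adj_sym by metis
  moreover have "h \<noteq> c" using rot_neq(2)[of b a] assms h adj_sym by metis
  moreover have "h \<noteq> d" using rot_neq(2)[of a d] assms h da adj_sym by metis
  ultimately show False
    using house[OF assms(1) bc cd da \<open>E a h\<close> \<open>E h b\<close>] by blast
qed

lemma no_consecutive_triangles_next_to_pentagon:
  assumes "E e a" "rot a e = b" "rot b a = c" "rot c b = d" "rot d c = e" "rot e d = a"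
    "tri a e" "tri b a"
  shows False
proof -
  obtain x where x: "rot e a = x" "rot x e = a" "rot a x = e" "E e x" "E x a"
    using triD[OF assms(7)] by metis
  obtain y where y: "rot a b = y" "rot y a = b" "rot b y = a" "E a y" "E y b"
    using triD[OF assms(8)] by metis
  have ab: "E a b" using assms(1,2) rot_adj adj_sym by metis
  have bc: "E b c" using ab assms(3) rot_adj adj_sym by metis
  have cd: "E c d" using bc assms(4) rot_adj adj_sym by metis
  have de: "E d e" using cd assms(5) rot_adj adj_sym by metis
  have cycle: "a \<noteq> c" "a \<noteq> d" "b \<noteq> d" "b \<noteq> e" "c \<noteq> e"
    using rot_neq(1)[OF adj_sym[OF ab]] rot_neq(1)[OF adj_sym[OF de]]
      rot_neq(1)[OF adj_sym[OF bc]] rot_neq(1)[OF adj_sym[OF assms(1)]]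
      rot_neq(1)[OF adj_sym[OF cd]] assms(2-6) by simp_all
  have ax: "E a x" using x adj_sym by blast
  have "x \<noteq> b" "x \<noteq> y" "e \<noteq> y"
    using rot_neq[of a x] rot_neq[of a e] x y assms ax adj_sym by metis+
  moreover have "x \<noteq> d" using rot_neq(2)[of e d] x assms de adj_sym by metis
  moreover have "y \<noteq> c" using rot_neq(2)[of b a] y assms ab adj_sym by metis
  \<comment> \<open>The rotations do not exclude this coincidence. It would supply the chord
    \<open>c e\<close>, hence the 4-cycle \<open>c e a b\<close> with roof \<open>d\<close>;
    symmetrically for \<open>y = d\<close>.\<close>
  moreover have "x \<noteq> c"
  proof
    assume "x = c"
    then show False
      using house[of c e a b d] cycle ab bc cd de x(5) assms(1) adj_sym adj_neq x(4) by metis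
  qed
  moreover have "y \<noteq> d"
  proof
    assume "y = d"
    then show False
      using house[of d b a e c] cycle ab bc cd de y(4,5) assms(1) adj_sym adj_neq by metis
  qed
  ultimately show False
    using double_house[OF ab bc cd de assms(1) adj_sym[OF x(4)] x(5) adj_sym[OF y(4)] y(5)] cycle
    by metis
qed

text \<open>The two ends of the corner and the apexes \<open>x\<close>, \<open>y\<close> of its
  triangles are all the neighbours of \<open>v\<close>. The face at \<open>v\<close> opposite the
  corner thus borders both triangles, so it cannot be a triangle itself.\<close>

lemma degree_4_corner:
  assumes "degree V E v = 4" "tri v u" "tri (rot v u) v"
  shows "\<not> tri v (rot u v)" "\<not> tri (rot v (rot v u)) v"
proof -
  obtain x where x: "rot u v = x" "rot v x = u" "E x v" "tri x v"
    using triD[OF assms(2)] by metis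
  define w where "w = rot v u"
  obtain y where y: "rot v w = y" "E v y" "tri v y"
    using triD[OF assms(3)] w_def by metis
  have vyx: "rot v y = x"
    using rot_degree_4(1)[of v x] x y assms(1) w_def adj_sym by metis
  have no: "\<not> tri y v"
    using no_two_adjacent_triangles[of y v] y(3) x(4) vyx by auto
  then show "\<not> tri (rot v (rot v u)) v"
    using y(1) w_def by simp
  have "tri y v" if vx: "tri v x"
  proof -
    obtain z where z: "tri z v" "rot v z = x"
      using triD[OF vx] by metis
    then have "E v z" using adj_sym by (auto simp: tri_def)
    with z show ?thesis using rot_inj[of v z y] vyx y(2) adj_sym by metis
  qed
  then show "\<not> tri v (rot u v)" using no x(1) by blast
qed

text \<open>The face walk is \<open>s v p q v r\<close>. A triangle on \<open>v s\<close> or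
  \<open>v p\<close> fixes its apex \<open>z\<close> as a third neighbour next to \<open>s\<close>
  and \<open>p\<close>; either remaining place for \<open>q\<close> in the rotation at
  \<open>v\<close> then forces \<open>r = s\<close> or a vertex of degree below 4.\<close>

lemma no_hexagon_through_vertex_twice:
  assumes "degree V E v = 4" "E s v" "rot v s = p" "rot p v = q" "rot q p = v" "rot v q = r"
    "rot r v = s" "rot s r = v" "q \<noteq> s"
  shows "\<not> tri v s" "\<not> tri p v"
proof -
  have vp: "E v p" using assms rot_adj adj_sym by metis
  have pq: "E p q" using vp assms rot_adj adj_sym by metis
  have qv: "E q v" using pq assms rot_adj adj_sym by metis
  have vr: "E v r" using qv assms rot_adj adj_sym by metis
  have rs: "E r s" using vr assms rot_adj adj_sym by metis
  show "\<not> tri p v"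
  proof
    assume "tri p v"
    then obtain z where z: "rot v p = z" "rot z v = p" "rot p z = v" "E v z"
      using triD by metis
    have "q \<in> {s, p, z, rot v z}"
      using rot_degree_4(2)[of v s q] assms z qv adj_sym by simp
    moreover have "q \<noteq> p" "q \<noteq> z" "q \<noteq> rot v z"
      using pq adj_neq rot_neq(2)[of p z] assms z vp adj_sym rs
        rot_degree_4(1)[of v s] rot_neq(2)[of p v] by metis+
    ultimately show False using assms(9) by blast
  qed
  show "\<not> tri v s"
  proof
    assume "tri v s"
    then obtain z where z: "rot s v = z" "rot z s = v" "rot v z = s" "E z v"
      using triD by metis
    have "q \<in> {z, s, p, rot v p}"
      using rot_degree_4(2)[of v z q] assms z qv adj_sym by simp
    moreover have "q \<noteq> p" "q \<noteq> z" using pq adj_neq assms z rs by metis+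
    moreover have "q \<noteq> rot v p"
    proof
      assume "q = rot v p"
      then have "r = z"
        using rot_degree_4(1)[of v z] assms z adj_sym by metis
      then show False using rot_neq(2)[of s r] assms z rs adj_sym by metis
    qed
    ultimately show False using assms(9) by blast
  qed
qed


section \<open>Faces as orbits of darts\<close>

abbreviation D :: "('a \<times> 'a) set" where "D \<equiv> darts V E"
abbreviation \<phi> :: "'a \<times> 'a \<Rightarrow> 'a \<times> 'a" where "\<phi> \<equiv> face_step rot"
abbreviation T :: "'a \<times> 'a \<Rightarrow> bool" where "T d \<equiv> tri (fst d) (snd d)"

lemma face_step_Pair: "\<phi> (u, v) = (v, rot v u)"
  by (simp add: face_step_def)

lemma dart_iff: "(u, v) \<in> D \<longleftrightarrow> E u v"
  using adj_in_V by (auto simp: darts_def)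

lemma finite_D: "finite D"
  by (rule finite_subset[of _ "V \<times> V"]) (use finite_V in \<open>auto simp: darts_def\<close>)

lemma face_step_bij: "bij_betw \<phi> D D"
proof -
  have into: "\<phi> ` D \<subseteq> D"
    using rot_adj adj_sym by (force simp: face_step_Pair dart_iff)
  have "inj_on \<phi> D"
    by (auto simp: inj_on_def face_step_Pair dart_iff dest: rot_inj[OF adj_sym adj_sym])
  then show ?thesis
    using endo_inj_surj[OF finite_D into] by (simp add: bij_betw_def)
qed

lemma face_step_in: "d \<in> D \<Longrightarrow> \<phi> d \<in> D"
  using face_step_bij bij_betwE by blast

lemma face_step_inj: "d \<in> D \<Longrightarrow> d' \<in> D \<Longrightarrow> \<phi> d = \<phi> d' \<Longrightarrow> d = d'"
  using face_step_bij by (meson bij_betw_imp_inj_on inj_onD)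

lemma funpow_face_step_in: "d \<in> D \<Longrightarrow> (\<phi> ^^ k) d \<in> D"
  by (induction k) (auto simp: face_step_in)

lemma swap_bij: "bij_betw prod.swap D D"
  by (rule bij_betw_byWitness[where f' = prod.swap]) (auto simp: dart_iff intro: adj_sym)

lemma self_in_face: "d \<in> D \<Longrightarrow> d \<in> orbit \<phi> d"
  by (rule self_in_orbit_finite[OF finite_D face_step_bij])

lemma faces_eq: "faces V E rot = orbit \<phi> ` D"
  unfolding faces_def by (intro image_cong refl) (simp add: orbit_altdef_self_in self_in_face)

lemma face_subset: "d \<in> D \<Longrightarrow> orbit \<phi> d \<subseteq> D"
  by (auto simp: orbit_altdef funpow_face_step_in)

lemma finite_face: "d \<in> D \<Longrightarrow> finite (orbit \<phi> d)"
  using face_subset finite_D finite_subset by blast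

lemma face_eq: "d \<in> D \<Longrightarrow> y \<in> orbit \<phi> d \<Longrightarrow> orbit \<phi> y = orbit \<phi> d"
  using self_in_face orbit_swap orbit_trans by (metis subsetI subset_antisym)

lemma face_step_bij_face:
  assumes "d \<in> D" shows "bij_betw \<phi> (orbit \<phi> d) (orbit \<phi> d)"
proof -
  have "inj_on \<phi> (orbit \<phi> d)"
    using face_step_bij face_subset[OF assms] by (meson bij_betw_imp_inj_on inj_on_subset)
  moreover have "\<phi> ` orbit \<phi> d \<subseteq> orbit \<phi> d"
    by (auto intro: orbit.step)
  ultimately show ?thesis
    using endo_inj_surj[OF finite_face[OF assms]] by (simp add: bij_betw_def)
qed

lemma sum_over_faces: "(\<Sum>d\<in>D. g d) = (\<Sum>f\<in>faces V E rot. \<Sum>d\<in>f. g d)"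
proof -
  have "D = \<Union>(orbit \<phi> ` D)"
    using self_in_face face_subset by blast
  moreover have "sum g (\<Union>(orbit \<phi> ` D)) = (sum \<circ> sum) g (orbit \<phi> ` D)"
    by (rule sum.Union_disjoint) (use finite_face face_eq in blast)+
  ultimately show ?thesis
    by (simp add: faces_eq)
qed

lemma face_triangle_iff: "T d \<longleftrightarrow> d \<in> D \<and> \<phi> (\<phi> (\<phi> d)) = d"
  by (cases d) (auto simp: tri_def face_step_Pair dart_iff)

lemma triangle_face_step: "T d \<Longrightarrow> T (\<phi> d)"
  by (simp add: face_triangle_iff face_step_in)

lemma triangle_face_step_iff: "d \<in> D \<Longrightarrow> T (\<phi> d) \<longleftrightarrow> T d"
  by (metis face_step_in face_step_inj face_triangle_iff)

lemma triangle_in_face: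
  assumes "d \<in> D" "y \<in> orbit \<phi> d" shows "T y \<longleftrightarrow> T d"
  using assms(2)
proof induction
  case (step y)
  then show ?case using triangle_face_step_iff face_subset[OF assms(1)] by blast
qed (use assms triangle_face_step_iff in blast)

lemma face_funpow_card:
  assumes "d \<in> D" "y \<in> orbit \<phi> d" shows "(\<phi> ^^ card (orbit \<phi> d)) y = y"
  using orbit_as_cycle(2)[of y \<phi>] assms face_eq face_subset self_in_face by (metis subsetD)

lemma face_length_ge_3: assumes "d \<in> D" shows "3 \<le> card (orbit \<phi> d)"
proof -
  obtain u v where d: "d = (u, v)" "E u v" using assms dart_iff by (cases d) auto
  have "card (orbit \<phi> d) \<noteq> 0" "(\<phi> ^^ card (orbit \<phi> d)) d = d"
    using orbit_as_cycle[OF self_in_face[OF assms]] by auto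
  moreover have "(\<phi> ^^ 1) d \<noteq> d"
    using d adj_neq by (auto simp: face_step_Pair)
  moreover have "(\<phi> ^^ 2) d \<noteq> d"
    using d rot_neq(1)[of v u] adj_sym by (auto simp: face_step_Pair numeral_eq_Suc)
  ultimately show ?thesis
    by (metis One_nat_def Suc_1 less_Suc_eq not_less numeral_3_eq_3 less_antisym less_one)
qed

lemma face_length_3_iff: assumes "d \<in> D" shows "card (orbit \<phi> d) = 3 \<longleftrightarrow> T d"
proof
  assume "card (orbit \<phi> d) = 3"
  then show "T d"
    using face_funpow_card[OF assms self_in_face[OF assms]] assms
    by (simp add: face_triangle_iff numeral_3_eq_3)
next
  assume "T d"
  then have "(\<phi> ^^ 3) d = d" by (simp add: face_triangle_iff numeral_3_eq_3)
  then have "orbit \<phi> d = (\<lambda>i. (\<phi> ^^ i) d) ` {..<3}"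
    by (rule orbit_eq_funpow_image) simp
  then have "card (orbit \<phi> d) \<le> 3"
    by (metis card_image_le finite_lessThan card_lessThan)
  then show "card (orbit \<phi> d) = 3"
    using face_length_ge_3[OF assms] by simp
qed

section \<open>Demands of triangles on neighbouring faces\<close>

text \<open>
  All discharging amounts are scaled by 6. The demand of an edge of a face is split between its two
  ends \<open>snd d\<close> and \<open>fst d\<close>, whence the two definitions.
\<close>
definition head_demand :: "'a \<times> 'a \<Rightarrow> int" where
  "head_demand d = of_bool (T (prod.swap d)) * (1 + of_bool (T (prod.swap (\<phi> (\<phi> (prod.swap d))))))"

definition tail_demand :: "'a \<times> 'a \<Rightarrow> int" where
  "tail_demand d = of_bool (T (prod.swap d)) * (1 + of_bool (T (prod.swap (\<phi> (prod.swap d)))))"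

text \<open>What the vertex \<open>snd d\<close> of degree at least 5 pays for this corner. The
  second condition says that the corner following it in the rotation lies in a triangle, which
  bounds how many corners at one vertex are paid for.\<close>

definition excess :: "'a \<times> 'a \<Rightarrow> int" where
  "excess d = (if \<not> T d \<and> T (prod.swap (\<phi> d)) \<and> 5 \<le> degree V E (snd d) then 2 else 0)"

lemma no_two_adjacent_triangular_faces:
  assumes "T d" "T (prod.swap d)" shows "\<not> T (prod.swap (\<phi> d))"
  using no_two_adjacent_triangles[of "fst d" "snd d"] assms
  by (cases d) (auto simp: face_step_Pair)

text \<open>At most one of the other two edges of the triangle borders a triangle, so at most one
  bonus occurs: the edge demands 2 or 3, that is six times 1/3 or 1/2.\<close>

lemma demand_le:
  assumes "d \<in> D"
  shows "head_demand d + tail_demand d \<le> 3 * of_bool (T (prod.swap d))"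
proof -
  have "\<not> (T (prod.swap (\<phi> (prod.swap d))) \<and> T (prod.swap (\<phi> (\<phi> (prod.swap d)))))"
    if "T (prod.swap d)"
    using no_two_adjacent_triangular_faces[of "\<phi> (prod.swap d)"] triangle_face_step[OF that] by blast
  then show ?thesis
    by (auto simp: head_demand_def tail_demand_def)
qed

text \<open>Each triangle collects 6 in all: 2 from each edge, or, if one edge is shared with a
  triangle, 3 from each of the other two.\<close>

lemma total_demand:
  "(\<Sum>d\<in>D. of_bool (\<not> T d) * (head_demand d + tail_demand d)) = (\<Sum>d\<in>D. 2 * of_bool (T d))"
proof -
  define t :: "'a \<times> 'a \<Rightarrow> int" where "t d = of_bool (T d)" for d
  define s :: "'a \<times> 'a \<Rightarrow> int" where "s d = of_bool (T (prod.swap d))" for d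
  have shift: "(\<Sum>d\<in>D. t d * s (\<phi> d)) = (\<Sum>d\<in>D. t d * s d)"
  proof -
    have "(\<Sum>d\<in>D. t d * s (\<phi> d)) = (\<Sum>d\<in>D. t (\<phi> d) * s (\<phi> d))"
      by (rule sum.cong) (auto simp: t_def triangle_face_step_iff)
    then show ?thesis
      using sum.reindex_bij_betw[OF face_step_bij, of "\<lambda>d. t d * s d"] by simp
  qed
  have shift2: "(\<Sum>d\<in>D. t d * s (\<phi> (\<phi> d))) = (\<Sum>d\<in>D. t d * s d)"
  proof -
    have "(\<Sum>d\<in>D. t d * s (\<phi> (\<phi> d))) = (\<Sum>d\<in>D. t (\<phi> d) * s (\<phi> (\<phi> d)))"
      by (rule sum.cong) (auto simp: t_def triangle_face_step_iff)
    then show ?thesis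
      using sum.reindex_bij_betw[OF face_step_bij, of "\<lambda>d. t d * s (\<phi> d)"] shift by simp
  qed
  have "(\<Sum>d\<in>D. of_bool (\<not> T d) * (head_demand d + tail_demand d))
      = (\<Sum>d\<in>D. (1 - s d) * (t d * (2 + s (\<phi> d) + s (\<phi> (\<phi> d)))))"
    by (subst sum.reindex_bij_betw[OF swap_bij, symmetric], rule sum.cong)
       (auto simp: head_demand_def tail_demand_def s_def t_def)
  \<comment> \<open>Products of \<open>t d\<close> with two factors \<open>s\<close> vanish, since a
    triangle has at most one triangular neighbour.\<close>
  also have "\<dots> = (\<Sum>d\<in>D. 2 * t d - 2 * (t d * s d) + t d * s (\<phi> d) + t d * s (\<phi> (\<phi> d)))"
  proof (rule sum.cong)
    fix d assume "d \<in> D"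
    have "\<not> (T d \<and> T (prod.swap d) \<and> T (prod.swap (\<phi> d)))"
      using no_two_adjacent_triangular_faces by blast
    moreover have "\<not> (T d \<and> T (prod.swap (\<phi> (\<phi> d))) \<and> T (prod.swap d))"
      using no_two_adjacent_triangular_faces[of "\<phi> (\<phi> d)"] triangle_face_step face_triangle_iff by metis
    ultimately show "(1 - s d) * (t d * (2 + s (\<phi> d) + s (\<phi> (\<phi> d))))
        = 2 * t d - 2 * (t d * s d) + t d * s (\<phi> d) + t d * s (\<phi> (\<phi> d))"
      by (auto simp: t_def s_def)
  qed simp
  also have "\<dots> = (\<Sum>d\<in>D. 2 * t d)"
    by (simp add: sum.distrib sum_subtractf shift shift2 sum_distrib_left[symmetric])
  finally show ?thesis by (simp add: t_def)
qed

text \<open>More than 2 arises only when both edges of the corner border triangles. At degree 4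
  neither half then carries a bonus, by \<open>degree_4_corner\<close>; at larger degree the sum is
  at most 4 and the excess covers the rest.\<close>

lemma corner_demand_le:
  assumes "d \<in> D" "\<not> T d"
  shows "head_demand d + tail_demand (\<phi> d) \<le> 2 + excess d"
proof (cases "T (prod.swap d) \<and> T (prod.swap (\<phi> d)) \<and> degree V E (snd d) \<le> 4")
  case True
  obtain u v where d: "d = (u, v)" "E u v" using assms dart_iff by (cases d) auto
  have "degree V E v = 4" using degree_ge_4[of v] True d adj_in_V by fastforce
  then have "\<not> tri v (rot u v)" "\<not> tri (rot v (rot v u)) v"
    using degree_4_corner[of v u] True d by (auto simp: face_step_Pair)
  moreover have "rot (rot u v) u = v"
    using triD[of v u] True d by (metis fst_conv snd_conv swap_simp)
  ultimately show ?thesis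
    using d by (auto simp: head_demand_def tail_demand_def face_step_Pair excess_def)
next
  case False
  then show ?thesis using assms(2)
    by (auto simp: head_demand_def tail_demand_def excess_def)
qed

section \<open>Demands on a face by its length\<close>

lemma quadrangle_demand:
  assumes "d \<in> D" "(\<phi> ^^ 4) d = d" shows "head_demand d + tail_demand d = 0"
proof -
  obtain a b where d: "d = (a, b)" "E a b" using assms dart_iff by (cases d) auto
  then have "\<not> T (prod.swap d)"
    using no_triangle_next_to_quadrangle[OF d(2) refl refl] assms(2) by (auto simp: face_step_Pair numeral_eq_Suc)
  then show ?thesis by (simp add: head_demand_def tail_demand_def)
qed

lemma pentagon_no_consecutive:
  assumes "d \<in> D" "(\<phi> ^^ 5) d = d" "T (prod.swap d)" shows "\<not> T (prod.swap (\<phi> d))"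
proof -
  obtain e a where d: "d = (e, a)" "E e a" using assms dart_iff by (cases d) auto
  then show ?thesis
    using no_consecutive_triangles_next_to_pentagon[OF d(2) refl refl refl] assms(2,3)
    by (auto simp: face_step_Pair numeral_eq_Suc)
qed

text \<open>Regroups from edges to corners: the tail half of an edge moves to the corner where the
  preceding dart ends.\<close>

lemma sum_face_demand_corners:
  assumes "d \<in> D"
  shows "(\<Sum>y\<in>orbit \<phi> d. head_demand y + tail_demand y)
    = (\<Sum>y\<in>orbit \<phi> d. head_demand y + tail_demand (\<phi> y))"
  using sum.reindex_bij_betw[OF face_step_bij_face[OF assms], of tail_demand]
  by (simp add: sum.distrib)

lemma face_demand_le:
  assumes "d \<in> D" "\<not> T d"
  shows "(\<Sum>y\<in>orbit \<phi> d. head_demand y + tail_demand y)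
    \<le> 6 * (int (card (orbit \<phi> d)) - 4) + (\<Sum>y\<in>orbit \<phi> d. excess y)"
proof -
  let ?n = "card (orbit \<phi> d)"
  have ex: "0 \<le> (\<Sum>y\<in>orbit \<phi> d. excess y)"
    by (rule sum_nonneg) (simp add: excess_def)
  have inD: "y \<in> D" "(\<phi> ^^ ?n) y = y" if "y \<in> orbit \<phi> d" for y
    using that face_subset[OF assms(1)] face_funpow_card[OF assms(1)] by auto
  have "3 \<le> ?n" "?n \<noteq> 3"
    using face_length_ge_3 face_length_3_iff assms by auto
  then consider "?n = 4" | "?n = 5" | "6 \<le> ?n" by linarith
  then show ?thesis
  proof cases
    case 1
    then have "(\<Sum>y\<in>orbit \<phi> d. head_demand y + tail_demand y) = 0"
      using quadrangle_demand inD by (intro sum.neutral) auto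
    then show ?thesis using 1 ex by simp
  next
    case 2
    define e where "e i = T (prod.swap ((\<phi> ^^ i) d))" for i
    have mem: "(\<phi> ^^ i) d \<in> orbit \<phi> d" for i
      using self_in_face[OF assms(1)] by (rule funpow_in_orbit)
    have cons: "\<not> (e i \<and> e (Suc i))" for i
      using pentagon_no_consecutive[of "(\<phi> ^^ i) d"] inD[OF mem] 2 by (auto simp: e_def)
    have "e 5 = e 0"
      using inD(2)[OF mem, of 0] 2 by (simp add: e_def)
    have "(\<Sum>y\<in>orbit \<phi> d. head_demand y + tail_demand y)
        \<le> (\<Sum>y\<in>orbit \<phi> d. 3 * of_bool (T (prod.swap y)))"
      by (rule sum_mono) (use demand_le inD in blast)
    also have "\<dots> = (\<Sum>i<5. 3 * of_bool (e i))"
      by (simp add: sum_orbit[OF self_in_face[OF assms(1)]] 2 e_def)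
    also have "\<dots> = 3 * (of_bool (e 0) + of_bool (e 1) + of_bool (e 2) + of_bool (e 3) + of_bool (e 4))"
      by (simp add: numeral_eq_Suc lessThan_Suc)
    \<comment> \<open>At most two of five cyclically arranged edges are pairwise non-consecutive,
      and each demands at most 3. The cycle closes through \<open>e 5 = e 0\<close>.\<close>
    also have "\<dots> \<le> 6"
      using cons[of 0] cons[of 1] cons[of 2] cons[of 3] cons[of 4] \<open>e 5 = e 0\<close>
      by (auto simp: eval_nat_numeral)
    finally show ?thesis using 2 ex by simp
  next
    case 3
    \<comment> \<open>Apart from excess, 2 per corner suffices because 2n is at most 6(n - 4) once n
      is at least 6.\<close>
    have "(\<Sum>y\<in>orbit \<phi> d. head_demand y + tail_demand (\<phi> y)) \<le> (\<Sum>y\<in>orbit \<phi> d. 2 + excess y)"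
      by (rule sum_mono) (use corner_demand_le inD triangle_in_face assms in blast)
    then show ?thesis
      using 3 sum_face_demand_corners[OF assms(1)] by (simp add: sum.distrib)
  qed
qed


section \<open>The Euler characteristic bound\<close>

lemma sum_darts_by_head: "(\<Sum>d\<in>D. g d) = (\<Sum>v\<in>V. \<Sum>u\<in>nbrs V E v. g (u, v))"
proof -
  have D: "D = (SIGMA v:V. nbrs V E v)"
    by (auto simp: darts_def nbrs_def)
  have "(\<Sum>d\<in>D. g d) = (\<Sum>d\<in>D. g (prod.swap d))"
    by (rule sum.reindex_bij_betw[OF swap_bij, symmetric])
  also have "\<dots> = (\<Sum>v\<in>V. \<Sum>u\<in>nbrs V E v. g (u, v))"
    unfolding D using finite_V finite_nbrs
    by (subst sum.Sigma) (auto simp: case_prod_beta prod.swap_def)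
  finally show ?thesis .
qed

lemma card_darts_degree: "int (card D) = (\<Sum>v\<in>V. int (degree V E v))"
  using sum_darts_by_head[of "\<lambda>_. 1 :: int"] by (simp add: degree_def)

lemma card_darts_edges: "card D = 2 * card (edge_set V E)"
proof -
  have edges: "edge_set V E = (\<lambda>d. {fst d, snd d}) ` D"
    by (fastforce simp: edge_set_def darts_def image_iff)
  have "card {d \<in> D. {fst d, snd d} = e} = 2" if edge: "e \<in> edge_set V E" for e
  proof -
    obtain u v where e: "e = {u, v}" "E u v" using edge by (auto simp: edge_set_def)
    then have "{d \<in> D. {fst d, snd d} = e} = {(u, v), (v, u)}"
      using adj_sym by (auto simp: dart_iff doubleton_eq_iff)
    then show ?thesis using e adj_neq by auto
  qed
  then have "(\<Sum>e\<in>edge_set V E. \<Sum>d\<in>{d \<in> D. {fst d, snd d} = e}. 1) = 2 * card (edge_set V E)"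
    by simp
  then show ?thesis
    using sum.image_gen[OF finite_D, of "\<lambda>_. 1 :: nat" "\<lambda>d. {fst d, snd d}"] by (simp add: edges)
qed

text \<open>
  Six times the charge left at a face. The triangular summand makes the gap of a triangle
  vanish, and it balances the demands over all faces by \<open>total_demand\<close>.
\<close>
definition face_gap :: "('a \<times> 'a) set \<Rightarrow> int" where
  "face_gap f = 6 * (int (card f) - 4) - (\<Sum>y\<in>f. of_bool (\<not> T y) * (head_demand y + tail_demand y))
     + (\<Sum>y\<in>f. 2 * of_bool (T y)) + (\<Sum>y\<in>f. excess y)"

lemma face_gap_nontriangle:
  assumes "d \<in> D" "\<not> T d"
  shows "face_gap (orbit \<phi> d) = 6 * (int (card (orbit \<phi> d)) - 4)
    - (\<Sum>y\<in>orbit \<phi> d. head_demand y + tail_demand y) + (\<Sum>y\<in>orbit \<phi> d. excess y)"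
  using triangle_in_face[OF assms(1)] assms(2) by (simp add: face_gap_def cong: sum.cong_simp)

lemma face_gap_nonneg:
  assumes "f \<in> faces V E rot" shows "0 \<le> face_gap f"
proof -
  obtain d where d: "d \<in> D" "f = orbit \<phi> d" using assms faces_eq by auto
  show ?thesis
  proof (cases "T d")
    case True
    have "0 \<le> (\<Sum>y\<in>orbit \<phi> d. excess y)"
      by (rule sum_nonneg) (simp add: excess_def)
    then show ?thesis
      using triangle_in_face[OF d(1)] True face_length_3_iff[OF d(1)] d(2)
      by (simp add: face_gap_def cong: sum.cong_simp)
  next
    case False
    then show ?thesis
      using face_gap_nontriangle[OF d(1)] face_demand_le[OF d(1)] d(2) by simp
  qed
qed

lemma sum_face_gap:
  "(\<Sum>f\<in>faces V E rot. face_gap f)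
    = 6 * int (card D) - 24 * int (card (faces V E rot)) + (\<Sum>d\<in>D. excess d)"
proof -
  have "int (card D) = (\<Sum>f\<in>faces V E rot. int (card f))"
    using sum_over_faces[of "\<lambda>_. 1 :: int"] by simp
  then show ?thesis
    unfolding face_gap_def sum.distrib sum_subtractf sum_over_faces[symmetric]
    by (simp add: total_demand sum_subtractf sum_distrib_left[symmetric] right_diff_distrib)
qed

lemma sum_excess_at_vertex:
  assumes "v \<in> V"
  shows "(\<Sum>u\<in>nbrs V E v. excess (u, v)) \<le> (if 5 \<le> degree V E v then int (degree V E v) else 0)"
proof (cases "5 \<le> degree V E v")
  case True
  have "(\<Sum>u\<in>nbrs V E v. excess (u, v))
      \<le> (\<Sum>u\<in>nbrs V E v. 1 - of_bool (tri u v) + of_bool (tri (rot v u) v))"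
    by (rule sum_mono) (auto simp: excess_def face_step_Pair)
  also have "\<dots> = int (degree V E v)"
    using sum.reindex_bij_betw[OF rot_bij[OF assms], of "\<lambda>u. of_bool (tri u v) :: int"]
    by (simp only: sum.distrib sum_subtractf) (simp add: degree_def)
  finally show ?thesis using True by simp
qed (simp add: excess_def)

text \<open>Total charge, scaled by 6. A vertex of degree k \<ge> 5 starts with 6k - 24 and pays at
  most k, so it keeps at least 5k - 24 \<ge> 1; a vertex of degree 4 has and pays nothing.\<close>

lemma emb_char_le: "24 * emb_char V E rot \<le> - int (card {v \<in> V. 5 \<le> degree V E v})
    - (\<Sum>f\<in>faces V E rot. face_gap f)"
proof -
  have "int (card {v \<in> V. 5 \<le> degree V E v}) = (\<Sum>v\<in>V. of_bool (5 \<le> degree V E v))"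
    using finite_V by (simp add: of_bool_def sum.If_cases Int_def)
  also have "\<dots> \<le> (\<Sum>v\<in>V. 6 * int (degree V E v) - 24 - (\<Sum>u\<in>nbrs V E v. excess (u, v)))"
  proof (rule sum_mono)
    fix v assume v: "v \<in> V"
    show "of_bool (5 \<le> degree V E v)
        \<le> 6 * int (degree V E v) - 24 - (\<Sum>u\<in>nbrs V E v. excess (u, v))"
      using sum_excess_at_vertex[OF v] degree_ge_4[OF v] by (cases "5 \<le> degree V E v") auto
  qed
  also have "\<dots> = 6 * int (card D) - 24 * int (card V) - (\<Sum>d\<in>D. excess d)"
    by (simp add: sum_subtractf card_darts_degree sum_distrib_left sum_darts_by_head[of excess])
  finally show ?thesis
    using card_darts_edges by (simp add: sum_face_gap emb_char_def)
qed

lemma emb_char_nonpos: "emb_char V E rot \<le> 0"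
proof -
  have "0 \<le> (\<Sum>f\<in>faces V E rot. face_gap f)"
    by (rule sum_nonneg) (rule face_gap_nonneg)
  then show ?thesis
    using emb_char_le by linarith
qed

lemma tight:
  assumes "0 \<le> emb_char V E rot"
  shows "v \<in> V \<Longrightarrow> degree V E v = 4" "f \<in> faces V E rot \<Longrightarrow> face_gap f = 0"
proof -
  have "0 \<le> (\<Sum>f\<in>faces V E rot. face_gap f)"
    by (rule sum_nonneg) (rule face_gap_nonneg)
  then have eq: "card {v \<in> V. 5 \<le> degree V E v} = 0" "(\<Sum>f\<in>faces V E rot. face_gap f) = 0"
    using emb_char_le assms by linarith+
  then have "{v \<in> V. 5 \<le> degree V E v} = {}"
    using finite_V by simp
  then show "v \<in> V \<Longrightarrow> degree V E v = 4"
    using degree_ge_4[of v] by fastforce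
  have "finite (faces V E rot)"
    using finite_D by (simp add: faces_eq)
  then show "f \<in> faces V E rot \<Longrightarrow> face_gap f = 0"
    using eq(2) face_gap_nonneg sum_nonneg_eq_0_iff by blast
qed

text \<open>All degrees are 4, so there is no excess and each corner demands at most 2. Zero gap
  then gives 6(n - 4) \<le> 2n, so n is 6 and each corner demands exactly 2, which needs a triangle
  on one of its edges.\<close>

lemma tight_face:
  assumes "0 \<le> emb_char V E rot" "d \<in> D" "6 \<le> card (orbit \<phi> d)"
  shows "card (orbit \<phi> d) = 6" "T (prod.swap d) \<or> T (prod.swap (\<phi> d))"
proof -
  have nT: "\<not> T d" using assms face_length_3_iff by fastforce
  have ex: "excess y = 0" if "y \<in> orbit \<phi> d" for y
  proof -
    have "snd y \<in> V" using that face_subset[OF assms(2)] by (auto simp: darts_def)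
    then show ?thesis using tight(1)[OF assms(1)] by (simp add: excess_def)
  qed
  have corner: "head_demand y + tail_demand (\<phi> y) \<le> 2" if "y \<in> orbit \<phi> d" for y
    using corner_demand_le[of y] ex[OF that] that face_subset[OF assms(2)]
      triangle_in_face[OF assms(2) that] nT by auto
  have gap: "6 * (int (card (orbit \<phi> d)) - 4) = (\<Sum>y\<in>orbit \<phi> d. head_demand y + tail_demand (\<phi> y))"
    using face_gap_nontriangle[OF assms(2) nT] tight(2)[OF assms(1), of "orbit \<phi> d"] assms(2)
      sum_face_demand_corners[OF assms(2)] ex by (simp add: faces_eq)
  also have "\<dots> \<le> (\<Sum>y\<in>orbit \<phi> d. 2)"
    by (rule sum_mono) (rule corner)
  finally show six: "card (orbit \<phi> d) = 6"
    using assms(3) by simp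
  have "(\<Sum>y\<in>orbit \<phi> d. 2 - (head_demand y + tail_demand (\<phi> y))) = 0"
    unfolding sum_subtractf gap[symmetric] by (simp add: six)
  then have "\<forall>y\<in>orbit \<phi> d. 2 - (head_demand y + tail_demand (\<phi> y)) = 0"
    by (subst (asm) sum_nonneg_eq_0_iff) (use corner finite_face assms(2) in auto)
  then have "head_demand d + tail_demand (\<phi> d) = 2"
    using self_in_face[OF assms(2)] by auto
  then show "T (prod.swap d) \<or> T (prod.swap (\<phi> d))"
    by (intro disjCI ccontr[of "T _"]) (simp add: head_demand_def tail_demand_def)
qed

section \<open>Face boundaries in the tight case\<close>

lemma face_step_head_neq:
  assumes "d \<in> D" shows "snd (\<phi> d) \<noteq> snd d" "snd (\<phi> (\<phi> d)) \<noteq> snd d"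
proof -
  obtain u v where d: "d = (u, v)" "E u v" using assms dart_iff by (cases d) auto
  have "E v (rot v u)" using d rot_adj adj_sym by blast
  then show "snd (\<phi> d) \<noteq> snd d" "snd (\<phi> (\<phi> d)) \<noteq> snd d"
    using d adj_neq rot_neq(1)[of "rot v u" v] adj_sym by (auto simp: face_step_Pair)
qed

text \<open>Two visits to a vertex are at least three steps apart in both directions around the
  face. Length at most 6 leaves only opposite visits in a hexagon, where the corner at
  \<open>d\<close> would border no triangle.\<close>

lemma face_visits_once:
  assumes "0 \<le> emb_char V E rot" "d \<in> D" "0 < i" "i < card (orbit \<phi> d)"
  shows "snd ((\<phi> ^^ i) d) \<noteq> snd d"
proof
  let ?n = "card (orbit \<phi> d)"
  assume same: "snd ((\<phi> ^^ i) d) = snd d"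
  have period: "(\<phi> ^^ ?n) d = d"
    using face_funpow_card self_in_face assms(2) by blast
  have in_D: "(\<phi> ^^ i) d \<in> D" using assms(2) by (rule funpow_face_step_in)
  have "i \<noteq> 1" "i \<noteq> 2"
    using face_step_head_neq[OF assms(2)] same by (auto simp: numeral_eq_Suc)
  moreover have "i + 1 \<noteq> ?n"
  proof
    assume n: "i + 1 = ?n"
    have "(\<phi> ^^ (i + 1)) d = d" unfolding n by (rule period)
    then show False using face_step_head_neq(1)[OF in_D] same by simp
  qed
  moreover have "i + 2 \<noteq> ?n"
  proof
    assume n: "i + 2 = ?n"
    have "(\<phi> ^^ (i + 2)) d = d" unfolding n by (rule period)
    then show False using face_step_head_neq(2)[OF in_D] same by simp
  qed
  moreover have "?n \<le> 6"
    using tight_face(1)[OF assms(1,2)] by linarith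
  ultimately have i: "i = 3" "?n = 6"
    using assms(3,4) by linarith+
  obtain s v where d: "d = (s, v)" "E s v" using assms dart_iff by (cases d) auto
  define p q r where "p = rot v s" and "q = rot p v" and "r = rot v q"
  have v: "rot q p = v" using same d i by (simp add: face_step_Pair numeral_eq_Suc p_def q_def)
  have "rot r v = s" "rot s r = v"
    using period d i(2) v by (auto simp: face_step_Pair numeral_eq_Suc p_def q_def r_def)
  moreover have "q \<noteq> s"
  proof
    assume "q = s"
    then have "T d"
      using d v by (simp add: tri_def p_def q_def)
    then show False
      using face_length_3_iff[OF assms(2)] i(2) by simp
  qed
  ultimately have "\<not> tri v s" "\<not> tri p v"
    using no_hexagon_through_vertex_twice[of v s p q r] tight(1)[OF assms(1)] d adj_in_V v
    by (auto simp: p_def q_def r_def)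
  then show False
    using tight_face(2)[OF assms(1,2)] i(2) d by (simp add: face_step_Pair p_def)
qed

section \<open>Two-connectedness in the tight case\<close>

lemma connected_minus_vertex:
  assumes "0 \<le> emb_char V E rot" "connected_graph V E" "x \<in> V"
  shows "connected_graph (V - {x}) (\<lambda>u v. E u v \<and> u \<noteq> x \<and> v \<noteq> x)"
proof -
  define R where "R = {(u, v). u \<in> V - {x} \<and> v \<in> V - {x} \<and> E u v \<and> u \<noteq> x \<and> v \<noteq> x}"
  have R_iff: "(u, v) \<in> R \<longleftrightarrow> E u v \<and> u \<noteq> x \<and> v \<noteq> x" for u v
    using adj_in_V by (auto simp: R_def)
  have R_sym: "(v, u) \<in> R\<^sup>*" if "(u, v) \<in> R\<^sup>*" for u v
  proof -
    have "R\<inverse> = R" using R_iff adj_sym by auto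
    then show ?thesis using that rtrancl_converseD[of u v R] rtrancl_converseI by metis
  qed
  \<comment> \<open>The face of the dart \<open>(u, x)\<close> leaves \<open>x\<close> towards
    \<open>rot x u\<close> and comes back through \<open>u\<close>; in between it avoids
    \<open>x\<close>.\<close>
  have next_nbr: "(rot x u, u) \<in> R\<^sup>*" if "E x u" for u
  proof -
    define d where "d = (u, x)"
    have d: "d \<in> D" using that adj_sym by (simp add: d_def dart_iff)
    let ?n = "card (orbit \<phi> d)"
    \<comment> \<open>The shift by 1 starts the path at \<open>rot x u\<close>, the head of
      \<open>\<phi> d\<close>; the last admissible exponent, \<open>?n - 1\<close>, gives the dart
      with head \<open>u\<close>.\<close>
    have chain: "i + 1 < ?n \<Longrightarrow> (rot x u, snd ((\<phi> ^^ (i + 1)) d)) \<in> R\<^sup>*" for i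
    proof (induction i)
      case 0
      then show ?case by (simp add: d_def face_step_Pair)
    next
      case (Suc i)
      obtain a b where ab: "(\<phi> ^^ (i + 1)) d = (a, b)" by (cases "(\<phi> ^^ (i + 1)) d")
      have next_ab: "(\<phi> ^^ (Suc i + 1)) d = (b, rot b a)" using ab by (simp add: face_step_Pair)
      have "E b (rot b a)"
        using funpow_face_step_in[OF d, of "Suc i + 1"] unfolding next_ab dart_iff .
      moreover have "b \<noteq> x" "rot b a \<noteq> x"
        using face_visits_once[OF assms(1) d, of "i + 1"] face_visits_once[OF assms(1) d, of "Suc i + 1"]
          Suc.prems by (simp_all only: ab next_ab) (simp_all add: d_def)
      ultimately have "(b, rot b a) \<in> R" using R_iff by blast
      moreover have "(rot x u, b) \<in> R\<^sup>*" using Suc ab by simp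
      ultimately show ?case
        unfolding next_ab snd_conv by (meson rtrancl.rtrancl_into_rtrancl)
    qed
    have n: "3 \<le> ?n" by (rule face_length_ge_3[OF d])
    have "\<phi> ((\<phi> ^^ (?n - 1)) d) = d"
      using face_funpow_card[OF d self_in_face[OF d]] n
      by (metis Suc_pred' diff_Suc_1 funpow.simps(2) o_apply not_numeral_le_zero gr0I)
    then have "snd ((\<phi> ^^ (?n - 1)) d) = u"
      by (simp add: face_step_def d_def)
    then show ?thesis
      using chain[of "?n - 2"] n by (simp add: numeral_eq_Suc Suc_diff_Suc)
  qed
  have nbrs_linked: "(w, u) \<in> R\<^sup>*" if adj: "E x u" "E x w" for u w
  proof -
    obtain k where "(rot x ^^ k) u = w" using rot_transitive[OF adj] by blast
    moreover have "E x ((rot x ^^ k) u) \<and> ((rot x ^^ k) u, u) \<in> R\<^sup>*" for k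
    proof (induction k)
      case (Suc k)
      then show ?case
        using next_nbr[of "(rot x ^^ k) u"] rot_adj by (auto intro: rtrancl_trans)
    qed (use adj in simp)
    ultimately show ?thesis by blast
  qed
  have "nbrs V E x \<noteq> {}"
    using degree_ge_4[OF assms(3)] by (auto simp: degree_def)
  then obtain u0 where u0: "E x u0" using nbrs_iff by blast
  \<comment> \<open>Follows a walk that starts at \<open>x\<close>: each time it leaves
    \<open>x\<close> it is at a neighbour of \<open>x\<close>, which is linked to \<open>u0\<close>
    by a path avoiding \<open>x\<close>.\<close>
  have reach: "w = x \<or> (u0, w) \<in> R\<^sup>*" if "w \<in> V" for w
  proof -
    have "(x, w) \<in> {(u, v). u \<in> V \<and> v \<in> V \<and> E u v}\<^sup>*"
      using assms(2,3) that by (simp add: connected_graph_def)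
    then show ?thesis
    proof induction
      case (step y z)
      then have "E y z" by simp
      show ?case
      proof (cases "y = x \<or> z = x")
        case True
        then show ?thesis using \<open>E y z\<close> nbrs_linked[of z u0] u0 by auto
      next
        case False
        then have "(y, z) \<in> R" using \<open>E y z\<close> R_iff by blast
        then show ?thesis using step.IH False by (meson rtrancl.rtrancl_into_rtrancl)
      qed
    qed simp
  qed
  have "(u, w) \<in> R\<^sup>*" if "u \<in> V - {x}" "w \<in> V - {x}" for u w
    using reach[of u] reach[of w] that R_sym by (auto intro: rtrancl_trans)
  moreover have "u0 \<in> V - {x}"
    using u0 adj_in_V adj_neq by blast
  ultimately show ?thesis
    unfolding connected_graph_def R_def[symmetric] by blast
qed

lemma two_connected:
  assumes "0 \<le> emb_char V E rot" "connected_graph V E"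
  shows "two_connected V E"
proof -
  obtain x where x: "x \<in> V" using assms(2) by (auto simp: connected_graph_def)
  have "degree V E x \<le> card V"
    unfolding degree_def nbrs_def by (rule card_mono) (use finite_V in auto)
  then have "3 \<le> card V" using degree_ge_4[OF x] by linarith
  then show ?thesis
    using assms connected_minus_vertex by (simp add: two_connected_def)
qed

end

theorem theorem1p2:
  fixes V :: "'a set" and E :: "'a \<Rightarrow> 'a \<Rightarrow> bool"
  assumes "simple_graph V E"
    and "connected_graph V E"
    and "toroidal V E"
    and "\<not> has_C1 V E"
    and "\<not> has_C2 V E"
  shows "min_degree_le V E 3 \<or>
         (two_connected V E \<and> regular V E 4 \<and> euler_char V E = 0)"
proof (cases "min_degree_le V E 3")
  case False
  then have deg: "4 \<le> degree V E v" if "v \<in> V" for v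
    using that by (force simp: min_degree_le_def)
  have embedding: "house_free_embedding V E rot" if "rotation_system V E rot" for rot
    using that assms(1,4,5) deg by unfold_locales
  obtain rot where rot: "rotation_system V E rot" "0 \<le> emb_char V E rot"
    using assms(3) by (auto simp: toroidal_def)
  interpret house_free_embedding V E rot by (rule embedding[OF rot(1)])
  \<comment> \<open>\<open>Max\<close> is meaningful only on a finite set; the lower bound holds
    because the number of faces is nonnegative.\<close>
  have "finite {emb_char V E r | r. rotation_system V E r}"
  proof (rule finite_subset)
    show "{emb_char V E r | r. rotation_system V E r}
        \<subseteq> {int (card V) - int (card (edge_set V E))..0}"
      using house_free_embedding.emb_char_nonpos[OF embedding] by (auto simp: emb_char_def)
  qed simp
  moreover have "emb_char V E rot = 0"
    using emb_char_nonpos rot(2) by simp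
  ultimately have "euler_char V E = 0"
    unfolding euler_char_def using rot(1) house_free_embedding.emb_char_nonpos[OF embedding]
    by (intro Max_eqI) force+
  moreover have "regular V E 4"
    using tight(1)[OF rot(2)] by (simp add: regular_def)
  ultimately show ?thesis
    using two_connected[OF rot(2) assms(2)] by blast
qed simp

end
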